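(* Let $\Gamma$ be a free abelian group of finite rank, let $M$ be a locally path-connected topological space and let $(Z_x,\mathfrak r_x,\mathfrak s_x)_{x\in M}$ be a continuous family of stable supports on $M$. Let $Q:\Gamma_{\mathbb R}\to\mathbb R$ be a quadratic form and let $x\in M$ be such that $Q$ is negative-definite on $\operatorname{Ker}(Z_x:\Gamma_{\mathbb R}\to\mathbb C)$ and $Q(\gamma)\ge0$ for all $\gamma\in\mathfrak s_x$. Then there is a neighborhood $U$ of $x$ in $M$ such that $Q(\gamma)\ge0$ for all $y\in U$ and all $\gamma\in\mathfrak s_y$.
   Context: $\Gamma_{\mathbb R}=\Gamma\otimes_{\mathbb Z}\mathbb R$ is equipped with a norm $\|\cdot\|$. Linear maps $Z:\Gamma\to\mathbb C$ are extended $\mathbb R$-linearly to $\Gamma_{\mathbb R}$. A ray in $\mathbb C$ is a set $\mathbb R_{>0}z$ with $z\ne0$. For a subset $A$ of $\Gamma$, $\operatorname{sgr}(A)=\{a_1+\dots+a_k : a_i\in A,\ k\ge1\}$ is the semigroup generated by $A$. A stable support is a triple $(Z,\mathfrak r,\mathfrak s)$, where $Z:\Gamma\to\mathbb C$ is a linear map and $\mathfrak r\subset\mathfrak s\subset\Gamma\setminus\{0\}$ are subsets such that, for some $\varepsilon>0$, $\mathfrak s\subset\{\gamma\in\Gamma : |Z(\gamma)|\ge\varepsilon\|\gamma\|\}$, and such that for every ray $\ell\subset\mathbb C$ we have $\mathfrak s\cap Z^{-1}(\ell)\subset\operatorname{sgr}(\mathfrak r\cap Z^{-1}(\ell))$.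 A continuous family of stable supports on a topological space $M$ is a collection of stable supports $(Z_x,\mathfrak r_x,\mathfrak s_x)_{x\in M}$ such that the map $M\to\operatorname{Hom}(\Gamma,\mathbb C)$, $x\mapsto Z_x$, is continuous and (1) for any $x\in M$ there exist $\varepsilon>0$ and an open set $x\in U\subset M$ such that $\mathfrak s_y\subset\{\gamma\in\Gamma : |Z_y(\gamma)|\ge\varepsilon\|\gamma\|\}$ for all $y\in U$; (2) for any $\gamma\in\Gamma$, the set $\{x\in M:\gamma\in\mathfrak r_x\}$ is open; (3) for any $\gamma\in\Gamma$, the set $\{x\in M:\gamma\in\mathfrak s_x\}$ is closed. *)

theory Defs
  imports "HOL-Analysis.Analysis"
begin

text \<open>
  An abelian group as an integer module. At most one of the two sums is nonempty.
\<close>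

definition int_scale :: "int \<Rightarrow> 'g::ab_group_add \<Rightarrow> 'g" where
  "int_scale k g = (\<Sum>i<nat k. g) - (\<Sum>i<nat (- k). g)"

lemma int_scale_diff:
  "int_scale (int m - int n) g = (\<Sum>i<m. g) - (\<Sum>i<n. g)"
proof -
  have split: "(\<Sum>i<a + b. g) = (\<Sum>i<a. g) + (\<Sum>i<b. g)" for a b :: nat
    by (induction b) (simp_all add: algebra_simps)
  show ?thesis
  proof (cases "n \<le> m")
    case True
    then obtain d where "m = n + d" using le_Suc_ex by blast
    then show ?thesis by (simp add: int_scale_def split)
  next
    case False
    then obtain d where "n = m + d" using le_Suc_ex nat_le_linear by blast
    then show ?thesis by (simp add: int_scale_def split)
  qed
qed

lemma int_scale_add_left: "int_scale (a + b) g = int_scale a g + int_scale b g"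
proof -
  have split: "(\<Sum>i<p + q. g) = (\<Sum>i<p. g) + (\<Sum>i<q. g)" for p q :: nat
    by (induction q) (simp_all add: algebra_simps)
  obtain m n where a: "a = int m - int n" by (rule int_diff_cases)
  obtain m' n' where b: "b = int m' - int n'" by (rule int_diff_cases)
  have "a + b = int (m + m') - int (n + n')" using a b by simp
  then show ?thesis
    by (simp only: a b int_scale_diff split) (simp add: algebra_simps)
qed

lemma int_scale_add_right: "int_scale a (g + h) = int_scale a g + int_scale a h"
  by (simp add: int_scale_def sum.distrib)

lemma int_scale_0_left [simp]: "int_scale 0 g = 0"
  and int_scale_1 [simp]: "int_scale 1 g = g"
  by (simp_all add: int_scale_def)

lemma int_scale_minus_left: "int_scale (- a) g = - int_scale a g"
  by (simp add: int_scale_def)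

lemma int_scale_scale: "int_scale a (int_scale b g) = int_scale (a * b) g"
proof (induction a rule: int_induct[where k = 0])
  case base
  then show ?case by simp
next
  case (step1 i)
  then show ?case by (simp add: int_scale_add_left distrib_right)
next
  case (step2 i)
  have "int_scale (i - 1) h = int_scale i h - h" for h :: 'a
    using int_scale_add_left[of i "-1" h] by (simp add: int_scale_minus_left)
  moreover have "int_scale ((i - 1) * b) g = int_scale (i * b) g - int_scale b g"
    using int_scale_add_left[of "i * b" "- b" g]
    by (simp add: int_scale_minus_left left_diff_distrib)
  ultimately show ?case using step2 by simp
qed

interpretation int_module: module int_scale
  by unfold_locales
    (simp_all add: int_scale_add_left int_scale_add_right int_scale_scale)

definition int_basis :: "'g::ab_group_add set \<Rightarrow> bool" where
  "int_basis B \<longleftrightarrow> int_module.independent B \<and> int_module.span B = UNIV"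

text \<open>
  \<open>real_extension \<iota>\<close> says that the real vector space \<open>'v\<close>, with the map
  \<open>\<gamma> \<mapsto> \<gamma> \<otimes> 1\<close> given by \<open>\<iota>\<close>, is a model of the tensor product of the free abelian group
  \<open>'g\<close> with the reals: integer bases go to real bases. The universal property is
  \<open>real_extension_ex1\<close> below.
\<close>

definition real_extension :: "('g::ab_group_add \<Rightarrow> 'v::real_vector) \<Rightarrow> bool" where
  "real_extension \<iota> \<longleftrightarrow> Modules.additive \<iota> \<and>
    (\<forall>B. int_basis B \<longrightarrow> inj_on \<iota> B \<and> independent (\<iota> ` B) \<and> span (\<iota> ` B) = UNIV)"

definition extend_linear ::
  "('g::ab_group_add \<Rightarrow> 'v::real_vector) \<Rightarrow> ('g \<Rightarrow> 'w::real_vector) \<Rightarrow> 'v \<Rightarrow> 'w" where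
  "extend_linear \<iota> f = (THE F. linear F \<and> (\<forall>\<gamma>. F (\<iota> \<gamma>) = f \<gamma>))"

lemma additive_int_scale:
  fixes f :: "'g::ab_group_add \<Rightarrow> 'w::ab_group_add"
  assumes "Modules.additive f"
  shows "f (int_scale k g) = int_scale k (f g)"
  by (simp only: int_scale_def additive.diff[OF assms] additive.sum[OF assms])

lemma additive_eq_on_int_basis:
  fixes f h :: "'g::ab_group_add \<Rightarrow> 'w::ab_group_add"
  assumes "int_basis B" "Modules.additive f" "Modules.additive h" "\<And>b. b \<in> B \<Longrightarrow> f b = h b"
  shows "f g = h g"
proof -
  have "g \<in> int_module.span B" using assms(1) by (simp add: int_basis_def)
  then obtain t r where "t \<subseteq> B" and g: "g = (\<Sum>a\<in>t. int_scale (r a) a)"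
    unfolding int_module.span_explicit by blast
  then show ?thesis
    unfolding g additive.sum[OF assms(2)] additive.sum[OF assms(3)]
    by (intro sum.cong refl) (use assms in \<open>auto simp: additive_int_scale\<close>)
qed

lemma real_extension_ex1:
  fixes \<iota> :: "'g::ab_group_add \<Rightarrow> 'v::real_vector" and f :: "'g \<Rightarrow> 'w::real_vector"
    and B :: "'g set"
  assumes "int_basis B" "real_extension \<iota>" "Modules.additive f"
  shows "\<exists>!F. linear F \<and> (\<forall>\<gamma>. F (\<iota> \<gamma>) = f \<gamma>)"
proof (rule ex_ex1I)
  have \<iota>: "Modules.additive \<iota>" "inj_on \<iota> B" "independent (\<iota> ` B)" "span (\<iota> ` B) = UNIV"
    using assms(1,2) by (auto simp: real_extension_def)
  obtain F where F: "linear F" "\<And>v. v \<in> \<iota> ` B \<Longrightarrow> F v = f (inv_into B \<iota> v)"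
    using linear_independent_extend[OF \<iota>(3), of "\<lambda>v. f (inv_into B \<iota> v)"] by blast
  have "Modules.additive (\<lambda>\<gamma>. F (\<iota> \<gamma>))"
    by (simp add: Modules.additive_def additive.add[OF \<iota>(1)] linear_add[OF F(1)])
  then have "F (\<iota> \<gamma>) = f \<gamma>" for \<gamma>
    by (rule additive_eq_on_int_basis[OF assms(1) _ assms(3)]) (simp add: F(2) \<iota>(2))
  with F(1) show "\<exists>F. linear F \<and> (\<forall>\<gamma>. F (\<iota> \<gamma>) = f \<gamma>)" by blast
  show "F1 = F2" if "linear F1 \<and> (\<forall>\<gamma>. F1 (\<iota> \<gamma>) = f \<gamma>)" "linear F2 \<and> (\<forall>\<gamma>. F2 (\<iota> \<gamma>) = f \<gamma>)"
    for F1 F2 :: "'v \<Rightarrow> 'w"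
  proof
    show "F1 v = F2 v" for v
      by (rule linear_eq_on[of F1 F2 v "\<iota> ` B"]) (use that \<iota>(4) in auto)
  qed
qed

lemma extend_linear:
  fixes \<iota> :: "'g::ab_group_add \<Rightarrow> 'v::real_vector" and f :: "'g \<Rightarrow> 'w::real_vector"
    and B :: "'g set"
  assumes "int_basis B" "real_extension \<iota>" "Modules.additive f"
  shows "linear (extend_linear \<iota> f)" and "extend_linear \<iota> f (\<iota> \<gamma>) = f \<gamma>"
  using theI'[OF real_extension_ex1[OF assms]] by (simp_all add: extend_linear_def)

definition quadratic_form :: "('v::real_vector \<Rightarrow> real) \<Rightarrow> bool" where
  "quadratic_form Q \<longleftrightarrow> (\<exists>b. bilinear b \<and> (\<forall>u v. b u v = b v u) \<and> (\<forall>v. Q v = b v v))"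

definition negative_definite_on :: "'v::real_vector set \<Rightarrow> ('v \<Rightarrow> real) \<Rightarrow> bool" where
  "negative_definite_on S Q \<longleftrightarrow> (\<forall>v\<in>S. v \<noteq> 0 \<longrightarrow> Q v < 0)"

definition is_ray :: "complex set \<Rightarrow> bool" where
  "is_ray l \<longleftrightarrow> (\<exists>z. z \<noteq> 0 \<and> l = {t *\<^sub>R z | t. t > 0})"

definition sgr :: "'g::ab_group_add set \<Rightarrow> 'g set" where
  "sgr A = {sum_list as | as. as \<noteq> [] \<and> set as \<subseteq> A}"

definition support_bound ::
  "('g::ab_group_add \<Rightarrow> 'v::real_normed_vector) \<Rightarrow> real \<Rightarrow> ('g \<Rightarrow> complex) \<Rightarrow> 'g set" where
  "support_bound \<iota> \<epsilon> Z = {\<gamma>. cmod (Z \<gamma>) \<ge> \<epsilon> * norm (\<iota> \<gamma>)}"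

definition stable_support ::
  "('g::ab_group_add \<Rightarrow> 'v::real_normed_vector) \<Rightarrow> ('g \<Rightarrow> complex) \<Rightarrow> 'g set \<Rightarrow> 'g set \<Rightarrow> bool" where
  "stable_support \<iota> Z r s \<longleftrightarrow>
    Modules.additive Z \<and> r \<subseteq> s \<and> s \<subseteq> UNIV - {0} \<and>
    (\<exists>\<epsilon>>0. s \<subseteq> support_bound \<iota> \<epsilon> Z) \<and>
    (\<forall>l. is_ray l \<longrightarrow> s \<inter> Z -` l \<subseteq> sgr (r \<inter> Z -` l))"

text \<open>
  Continuity of \<open>Z\<close> refers to the topology of pointwise convergence on \<open>'g \<Rightarrow> complex\<close>. For a
  finitely generated group this induces the usual vector space topology on the space of
  homomorphisms to the complex numbers.
\<close>

definition continuous_family_of_stable_supports ::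
  "('g::ab_group_add \<Rightarrow> 'v::real_normed_vector) \<Rightarrow>
    ('m::topological_space \<Rightarrow> 'g \<Rightarrow> complex) \<Rightarrow> ('m \<Rightarrow> 'g set) \<Rightarrow> ('m \<Rightarrow> 'g set) \<Rightarrow> bool" where
  "continuous_family_of_stable_supports \<iota> Z r s \<longleftrightarrow>
    (\<forall>x. stable_support \<iota> (Z x) (r x) (s x)) \<and>
    continuous_on UNIV Z \<and>
    (\<forall>x. \<exists>\<epsilon>>0. \<exists>U. open U \<and> x \<in> U \<and> (\<forall>y\<in>U. s y \<subseteq> support_bound \<iota> \<epsilon> (Z y))) \<and>
    (\<forall>\<gamma>. open {x. \<gamma> \<in> r x}) \<and>
    (\<forall>\<gamma>. closed {x. \<gamma> \<in> s x})"

end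

theory Submission
  imports Defs
begin

text \<open>
  On a connected neighbourhood \<open>V\<close> of \<open>x\<close> the form \<open>Q\<close> stays negative definite on the kernel of
  \<open>Z\<^sub>y\<close>, so that along a ray of \<open>Z\<^sub>y\<close> the vectors with \<open>Q \<ge> 0\<close> are closed under addition. Hence
  if \<open>Q(\<gamma>) < 0\<close> for some \<open>\<gamma> \<in> s\<^sub>y\<close>, then \<open>Q(a) < 0\<close> for a summand \<open>a \<in> r\<^sub>y\<close> of \<open>\<gamma>\<close>. If \<open>Z\<^sub>y\<close> is
  close to \<open>Z\<^sub>x\<close>, the summands of \<open>\<gamma>\<close> have images under \<open>Z\<^sub>x\<close> pairwise at acute angles, so
  \<open>|Z\<^sub>x(a)| < |Z\<^sub>x(\<gamma>)|\<close> unless \<open>a = \<gamma>\<close>. Only finitely many \<open>\<gamma>\<close> satisfy \<open>|Z\<^sub>x(\<gamma>)| \<le> N\<close>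
  and lie in some \<open>s\<^sub>y\<close>. So the set of \<open>y \<in> V\<close> for which \<open>s\<^sub>y\<close> contains a \<open>\<gamma>\<close> with \<open>Q(\<gamma>) < 0\<close>
  and \<open>|Z\<^sub>x(\<gamma>)| \<le> N\<close> is closed in \<open>V\<close>; it is open because a minimal such \<open>\<gamma>\<close> lies in \<open>r\<^sub>y\<close>; and
  it misses \<open>x\<close>, so it is empty.
\<close>

section \<open>Finite-dimensional normed spaces\<close>

text \<open>The norm of the combination is a continuous function of the coefficients. On the compact
  l1 unit sphere it is positive by independence, so its minimum there serves as \<open>c\<close>;
  homogeneity does the rest. This bounds coordinates by the norm without assuming an inner
  product.\<close>

lemma independent_norm_lower_bound:
  fixes B :: "'v::real_normed_vector set"
  assumes "finite B" "independent B"
  shows "\<exists>c>0. \<forall>a. c * (\<Sum>b\<in>B. \<bar>a b\<bar>) \<le> norm (\<Sum>b\<in>B. a b *\<^sub>R b)"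
proof (cases "B = {}")
  case True
  then show ?thesis by (auto intro: exI[of _ 1])
next
  case False
  define h :: "('v \<Rightarrow> real) \<Rightarrow> real" where "h a = norm (\<Sum>b\<in>B. a b *\<^sub>R b)" for a
  \<comment> \<open>Coefficients outside \<open>B\<close> are pinned to 0, so that a product over
    the whole type is compact by Tychonoff and \<open>K\<close> is a copy of the l1 unit
    sphere.\<close>
  define P :: "('v \<Rightarrow> real) set" where
    "P = PiE UNIV (\<lambda>b. if b \<in> B then {-1..1} else {0})"
  define K where "K = P \<inter> {a. (\<Sum>b\<in>B. \<bar>a b\<bar>) = 1}"
  have "compact P"
    unfolding P_def compactin_euclidean_iff[symmetric] euclidean_product_topology[symmetric]
    by (subst compactin_PiE) auto
  moreover have "closed {a :: 'v \<Rightarrow> real. (\<Sum>b\<in>B. \<bar>a b\<bar>) = 1}"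
    by (intro closed_Collect_eq continuous_intros continuous_on_product_coordinates)
  ultimately have "compact K" by (simp add: K_def compact_Int_closed)
  obtain b0 where "b0 \<in> B" using False by blast
  have "(\<lambda>b. if b = b0 then 1 else 0) \<in> K"
    using \<open>b0 \<in> B\<close> \<open>finite B\<close> by (auto simp: K_def P_def if_distrib[of abs] cong: if_cong)
  then have "K \<noteq> {}" by blast
  have "continuous_on K h"
    unfolding h_def
    by (rule continuous_on_subset[of UNIV])
       (intro continuous_intros continuous_on_product_coordinates, simp)
  then obtain a0 where a0: "a0 \<in> K" "\<And>a. a \<in> K \<Longrightarrow> h a0 \<le> h a"
    using continuous_attains_inf[OF \<open>compact K\<close> \<open>K \<noteq> {}\<close>] by blast
  have "h a0 > 0"
  proof (rule ccontr)
    assume "\<not> h a0 > 0"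
    then have "(\<Sum>b\<in>B. a0 b *\<^sub>R b) = 0" by (simp add: h_def)
    then have "\<forall>b\<in>B. a0 b = 0"
      using independentD[OF \<open>independent B\<close> \<open>finite B\<close> order.refl] by blast
    then show False using a0(1) by (simp add: K_def)
  qed
  moreover have "h a0 * (\<Sum>b\<in>B. \<bar>a b\<bar>) \<le> norm (\<Sum>b\<in>B. a b *\<^sub>R b)" for a
  proof (cases "(\<Sum>b\<in>B. \<bar>a b\<bar>) = 0")
    case False
    define s where "s = (\<Sum>b\<in>B. \<bar>a b\<bar>)"
    have "s > 0" using False by (simp add: s_def order.not_eq_order_implies_strict sum_nonneg)
    define a' where "a' = (\<lambda>b. if b \<in> B then a b / s else 0)"
    have "\<bar>a b\<bar> \<le> s" if "b \<in> B" for b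
      unfolding s_def by (rule member_le_sum) (use that \<open>finite B\<close> in auto)
    then have "a' \<in> P" using \<open>s > 0\<close>
      by (auto simp: P_def a'_def abs_le_iff divide_le_eq le_divide_eq minus_le_iff)
    moreover have "(\<Sum>b\<in>B. \<bar>a' b\<bar>) = 1"
      using \<open>s > 0\<close> by (simp add: a'_def flip: sum_divide_distrib) (simp add: s_def)
    ultimately have "h a0 \<le> h a'" using a0(2) by (simp add: K_def)
    also have "h a' = norm ((1 / s) *\<^sub>R (\<Sum>b\<in>B. a b *\<^sub>R b))"
      by (simp add: h_def a'_def scaleR_sum_right)
    finally show ?thesis using \<open>s > 0\<close> by (simp add: s_def[symmetric] field_simps)
  qed simp
  ultimately show ?thesis by blast
qed

text \<open>Coordinates of \<open>v\<close> are bounded by \<open>norm v / c\<close>, so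
  \<open>C = 1 / c\<close> works. The point is that \<open>C\<close> depends on the basis only:
  values on finitely many vectors control a linear map uniformly in the map.\<close>

lemma finite_basis_linear_norm_bound:
  fixes B :: "'v::real_normed_vector set"
  assumes "finite B" "independent B" "span B = UNIV"
  obtains C where "C > 0"
    "\<And>(f :: 'v \<Rightarrow> 'w::real_normed_vector) M v.
      linear f \<Longrightarrow> (\<And>b. b \<in> B \<Longrightarrow> norm (f b) \<le> M) \<Longrightarrow> norm (f v) \<le> C * M * norm v"
proof -
  obtain c where c: "c > 0"
    "\<And>a. c * (\<Sum>b\<in>B. \<bar>a b\<bar>) \<le> norm (\<Sum>b\<in>B. a b *\<^sub>R b)"
    using independent_norm_lower_bound[OF assms(1,2)] by blast
  have "norm (f v) \<le> 1 / c * M * norm v"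
    if f: "linear f" and M: "\<And>b. b \<in> B \<Longrightarrow> norm (f b) \<le> M"
    for f :: "'v \<Rightarrow> 'w" and M v
  proof (cases "B = {}")
    \<comment> \<open>For an empty basis \<open>M\<close> is unconstrained and may be negative, but
      the space is zero.\<close>
    case True
    then have "v = 0" using assms(3) by auto
    then show ?thesis using linear_0[OF f] by simp
  next
    case False
    then obtain b where "b \<in> B" by blast
    then have "0 \<le> M" using M[of b] norm_ge_zero[of "f b"] by linarith
    have "v \<in> range (\<lambda>a. \<Sum>b\<in>B. a b *\<^sub>R b)"
      using assms(3) by (simp add: real_vector.span_finite[OF assms(1), symmetric])
    then obtain a where v: "v = (\<Sum>b\<in>B. a b *\<^sub>R b)" by blast
    have "norm (f v) \<le> (\<Sum>b\<in>B. norm (a b *\<^sub>R f b))"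
      unfolding v by (simp add: linear_sum[OF f] linear_scale[OF f] norm_sum del: norm_scaleR)
    also have "\<dots> \<le> (\<Sum>b\<in>B. \<bar>a b\<bar> * M)"
      by (intro sum_mono) (simp add: M mult_left_mono)
    also have "\<dots> = (\<Sum>b\<in>B. \<bar>a b\<bar>) * M" by (simp add: sum_distrib_right)
    also have "\<dots> \<le> (norm v / c) * M"
      by (intro mult_right_mono \<open>0 \<le> M\<close>)
         (use c(1) c(2)[of a] in \<open>simp add: v field_simps\<close>)
    finally show ?thesis by (simp add: field_simps)
  qed
  with c(1) show ?thesis by (intro that[of "1 / c"]) auto
qed

lemma finite_basis_linear_imp_bounded_linear:
  fixes B :: "'v::real_normed_vector set" and f :: "'v \<Rightarrow> 'w::real_normed_vector"
  assumes "finite B" "independent B" "span B = UNIV" "linear f"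
  shows "bounded_linear f"
proof -
  obtain C where C: "\<And>(f :: 'v \<Rightarrow> 'w) M v.
      linear f \<Longrightarrow> (\<And>b. b \<in> B \<Longrightarrow> norm (f b) \<le> M) \<Longrightarrow> norm (f v) \<le> C * M * norm v"
    using finite_basis_linear_norm_bound[OF assms(1-3)] by blast
  have "norm (f v) \<le> C * (\<Sum>b\<in>B. norm (f b)) * norm v" for v
    by (rule C[OF assms(4)]) (rule member_le_sum, use assms(1) in auto)
  then show ?thesis
    using assms(4) by (intro bounded_linear_intro[of f "C * (\<Sum>b\<in>B. norm (f b))"])
      (simp_all add: linear_add linear_scale mult.commute)
qed

text \<open>Points of the sphere have coordinates in the box of half-width \<open>r / c\<close>. The
  sphere is thus a closed subset of the continuous image of a compact box.\<close>

lemma finite_basis_compact_sphere: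
  fixes B :: "'v::real_normed_vector set"
  assumes "finite B" "independent B" "span B = UNIV"
  shows "compact (sphere (0 :: 'v) r)"
proof -
  obtain c where c: "c > 0"
    "\<And>a. c * (\<Sum>b\<in>B. \<bar>a b\<bar>) \<le> norm (\<Sum>b\<in>B. a b *\<^sub>R b)"
    using independent_norm_lower_bound[OF assms(1,2)] by blast
  define P :: "('v \<Rightarrow> real) set" where
    "P = PiE UNIV (\<lambda>b. if b \<in> B then {- (r / c)..r / c} else {0})"
  define g :: "('v \<Rightarrow> real) \<Rightarrow> 'v" where "g a = (\<Sum>b\<in>B. a b *\<^sub>R b)" for a
  have "compact P"
    unfolding P_def compactin_euclidean_iff[symmetric] euclidean_product_topology[symmetric]
    by (subst compactin_PiE) auto
  moreover have "continuous_on P g"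
    unfolding g_def
    by (rule continuous_on_subset[of UNIV])
       (intro continuous_intros continuous_on_product_coordinates, simp)
  ultimately have "compact (g ` P)" by (rule compact_continuous_image[rotated])
  moreover have "sphere 0 r \<subseteq> g ` P"
  proof
    fix v :: 'v assume "v \<in> sphere 0 r"
    then have r: "norm v = r" by simp
    have "v \<in> range (\<lambda>a. \<Sum>b\<in>B. a b *\<^sub>R b)"
      using assms(3) by (simp add: real_vector.span_finite[OF assms(1), symmetric])
    then obtain a where v: "v = (\<Sum>b\<in>B. a b *\<^sub>R b)" by blast
    have "\<bar>a b\<bar> \<le> r / c" if "b \<in> B" for b
    proof -
      have "\<bar>a b\<bar> \<le> (\<Sum>b\<in>B. \<bar>a b\<bar>)" by (rule member_le_sum) (use that assms(1) in auto)
      also have "\<dots> \<le> r / c" using c(1) c(2)[of a] r by (simp add: v field_simps)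
      finally show ?thesis .
    qed
    then have "(\<lambda>b. if b \<in> B then a b else 0) \<in> P"
      by (auto simp: P_def abs_le_iff minus_le_iff)
    moreover have "g (\<lambda>b. if b \<in> B then a b else 0) = v" by (simp add: g_def v)
    ultimately show "v \<in> g ` P" by (metis imageI)
  qed
  moreover have "closed (sphere (0 :: 'v) r)"
    unfolding sphere_def by (intro closed_Collect_eq continuous_intros)
  ultimately show ?thesis
    using compact_Int_closed[of "g ` P" "sphere 0 r"] by (simp add: inf.absorb2)
qed

section \<open>Quadratic forms negative-definite on the kernel of a linear map\<close>

lemma finite_basis_continuous_on_quadratic_form:
  fixes B :: "'v::real_normed_vector set" and Q :: "'v \<Rightarrow> real"
  assumes "finite B" "independent B" "span B = UNIV" and Q: "quadratic_form Q"
  shows "continuous_on S Q"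
proof -
  obtain \<beta> where \<beta>: "bilinear \<beta>" "\<And>v. Q v = \<beta> v v"
    using Q by (auto simp: quadratic_form_def)
  define \<rho> where "\<rho> = (\<lambda>b v. representation B v b)"
  have "linear (\<rho> b)" for b
    using real_vector.linear_representation[OF assms(2,3), of b]
    unfolding linear_def real_scaleR_def[abs_def] \<rho>_def .
  then have cont: "continuous_on S (\<rho> b)" for b
    by (intro linear_continuous_on finite_basis_linear_imp_bounded_linear[OF assms(1-3)])
  \<comment> \<open>In coordinates \<open>Q\<close> is a polynomial in the continuous functionals
    \<open>\<rho> b\<close>.\<close>
  have "Q v = (\<Sum>(b, b')\<in>B \<times> B. \<rho> b v * (\<rho> b' v * \<beta> b b'))" for v
  proof -
    have v: "v = (\<Sum>b\<in>B. \<rho> b v *\<^sub>R b)"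
      using real_vector.sum_representation_eq[OF assms(2) _ assms(1) order.refl, of v] assms(3)
      by (simp add: \<rho>_def)
    have "Q v = \<beta> (\<Sum>b\<in>B. \<rho> b v *\<^sub>R b) (\<Sum>b\<in>B. \<rho> b v *\<^sub>R b)"
      using \<beta>(2)[of v] by (metis v)
    then show ?thesis
      by (simp add: bilinear_sum[OF \<beta>(1)] bilinear_lmul[OF \<beta>(1)] bilinear_rmul[OF \<beta>(1)]
          mult.left_commute)
  qed
  then have "Q = (\<lambda>v. \<Sum>p\<in>B \<times> B. \<rho> (fst p) v * (\<rho> (snd p) v * \<beta> (fst p) (snd p)))"
    by (simp add: fun_eq_iff case_prod_beta)
  then show ?thesis
    by (simp add: cont continuous_on_mult continuous_on_sum)
qed

lemma quadratic_form_scaleR: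
  assumes "quadratic_form Q"
  shows "Q (t *\<^sub>R v) = t\<^sup>2 * Q v"
  using assms by (auto simp: quadratic_form_def bilinear_lmul bilinear_rmul power2_eq_square)

text \<open>On the compact set of unit vectors with \<open>Q \<ge> 0\<close> the map
  \<open>L\<close> has no zero, so \<open>norm (L v)\<close> has a positive minimum
  \<open>\<kappa>\<close> there; scaling extends the bound. A perturbation of \<open>L\<close>
  smaller than \<open>\<kappa>\<close> therefore keeps \<open>Q\<close> negative-definite on the
  kernel.\<close>

lemma negative_definite_kernel_bound:
  fixes B :: "'v::real_normed_vector set" and L :: "'v \<Rightarrow> 'w::real_normed_vector"
  assumes B: "finite B" "independent B" "span B = UNIV"
    and Q: "quadratic_form Q" and L: "linear L" and neg: "negative_definite_on {v. L v = 0} Q"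
  obtains \<kappa> where "\<kappa> > 0" "\<And>v. Q v \<ge> 0 \<Longrightarrow> \<kappa> * norm v \<le> norm (L v)"
proof -
  define S where "S = sphere 0 1 \<inter> {v. Q v \<ge> 0}"
  have "compact S"
    unfolding S_def
    by (intro compact_Int_closed finite_basis_compact_sphere[OF B] closed_Collect_le
        finite_basis_continuous_on_quadratic_form[OF B Q] continuous_intros)
  have cont: "continuous_on S (\<lambda>v. norm (L v))"
    by (intro continuous_intros linear_continuous_on finite_basis_linear_imp_bounded_linear[OF B L])
  obtain \<kappa> where \<kappa>: "\<kappa> > 0" "\<And>v. v \<in> S \<Longrightarrow> \<kappa> \<le> norm (L v)"
  proof (cases "S = {}")
    case True
    \<comment> \<open>If \<open>S\<close> is empty, only the zero vector has
      \<open>Q \<ge> 0\<close>, and any positive constant will do.\<close>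
    then show ?thesis by (intro that[of 1]) auto
  next
    case False
    then obtain v0 where v0: "v0 \<in> S" "\<And>v. v \<in> S \<Longrightarrow> norm (L v0) \<le> norm (L v)"
      using continuous_attains_inf[OF \<open>compact S\<close> _ cont] by blast
    have "v0 \<noteq> 0" "Q v0 \<ge> 0" using v0(1) by (auto simp: S_def)
    then have "L v0 \<noteq> 0" using neg by (force simp: negative_definite_on_def)
    then show ?thesis using v0(2) by (intro that[of "norm (L v0)"]) auto
  qed
  have "\<kappa> * norm v \<le> norm (L v)" if "Q v \<ge> 0" for v
  proof (cases "v = 0")
    case False
    then have "(1 / norm v) *\<^sub>R v \<in> S"
      using that by (simp add: S_def quadratic_form_scaleR[OF Q])
    from \<kappa>(2)[OF this] False show ?thesis by (simp add: linear_scale[OF L] field_simps)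
  qed (simp add: linear_0[OF L])
  with \<kappa>(1) that show ?thesis by blast
qed

text \<open>The combination \<open>\<beta> *\<^sub>R u - \<alpha> *\<^sub>R v\<close> lies in the
  kernel, so \<open>Q\<close> is at most 0 on it. Expanding, \<open>Q u \<ge> 0\<close> and
  \<open>Q v \<ge> 0\<close> force the mixed term \<open>b u v\<close> to be nonnegative.\<close>

lemma quadratic_form_nonneg_add_on_ray:
  assumes Q: "quadratic_form Q" and L: "linear L" and neg: "negative_definite_on {v. L v = 0} Q"
    and u: "L u = \<alpha> *\<^sub>R z" "\<alpha> > 0" "Q u \<ge> 0"
    and v: "L v = \<beta> *\<^sub>R z" "\<beta> > 0" "Q v \<ge> 0"
  shows "Q (u + v) \<ge> 0"
proof -
  obtain b where b: "bilinear b" "\<And>u v. b u v = b v u" "\<And>v. Q v = b v v"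
    using Q by (auto simp: quadratic_form_def)
  define w where "w = \<beta> *\<^sub>R u - \<alpha> *\<^sub>R v"
  have "L w = 0" by (simp add: w_def linear_diff[OF L] linear_scale[OF L] u(1) v(1))
  have "Q 0 = 0" using b(1,3) by (simp add: bilinear_lzero)
  with \<open>L w = 0\<close> neg have "Q w \<le> 0"
    by (cases "w = 0") (auto simp: negative_definite_on_def intro: less_imp_le)
  also have "Q w = \<beta>\<^sup>2 * Q u + \<alpha>\<^sup>2 * Q v - 2 * (\<alpha> * \<beta>) * b u v"
    using b(2)[of v u]
    by (simp add: w_def b(3) bilinear_lsub[OF b(1)] bilinear_rsub[OF b(1)]
        bilinear_lmul[OF b(1)] bilinear_rmul[OF b(1)] power2_eq_square algebra_simps)
  finally have "0 \<le> 2 * (\<alpha> * \<beta>) * b u v"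
    using u(3) v(3) by (smt (verit) mult_nonneg_nonneg zero_le_power2)
  moreover have "0 < \<alpha> * \<beta>" using u(2) v(2) by simp
  ultimately have "b u v \<ge> 0" by (simp add: zero_le_mult_iff)
  moreover have "Q (u + v) = Q u + Q v + 2 * b u v"
    using b(2)[of v u] by (simp add: b(3) bilinear_ladd[OF b(1)] bilinear_radd[OF b(1)])
  ultimately show ?thesis using u(3) v(3) by simp
qed

section \<open>Lattices\<close>

lemma int_scale_eq_scaleR: "int_scale k (v :: 'v::real_vector) = of_int k *\<^sub>R v"
proof -
  have "(\<Sum>i<n. v) = real n *\<^sub>R v" for n :: nat by (simp add: sum_constant_scaleR)
  then show ?thesis
    by (cases "k \<ge> 0") (simp_all add: int_scale_def)
qed

lemma finite_lattice_norm_le: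
  fixes \<iota> :: "'g::ab_group_add \<Rightarrow> 'v::real_normed_vector" and B :: "'g set"
  assumes "finite B" "int_basis B" "real_extension \<iota>"
  shows "finite {\<gamma>. norm (\<iota> \<gamma>) \<le> R}"
proof -
  have \<iota>: "Modules.additive \<iota>" "inj_on \<iota> B" "independent (\<iota> ` B)"
    using assms(2,3) by (auto simp: real_extension_def)
  obtain c where c: "c > 0"
    "\<And>a. c * (\<Sum>v\<in>\<iota> ` B. \<bar>a v\<bar>) \<le> norm (\<Sum>v\<in>\<iota> ` B. a v *\<^sub>R v)"
    using independent_norm_lower_bound[of "\<iota> ` B"] \<iota>(3) assms(1) by blast
  define n where "n = \<lceil>R / c\<rceil>"
  have "{\<gamma>. norm (\<iota> \<gamma>) \<le> R} \<subseteq> (\<lambda>k. \<Sum>b\<in>B. int_scale (k b) b) ` (B \<rightarrow>\<^sub>E {- n..n})"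
  proof
    fix \<gamma> assume "\<gamma> \<in> {\<gamma>. norm (\<iota> \<gamma>) \<le> R}"
    then have R: "norm (\<iota> \<gamma>) \<le> R" by simp
    have "\<gamma> \<in> int_module.span B" using assms(2) by (simp add: int_basis_def)
    then obtain k where k: "\<gamma> = (\<Sum>b\<in>B. int_scale (k b) b)"
      unfolding int_module.span_finite[OF assms(1)] by blast
    define a where "a v = real_of_int (k (inv_into B \<iota> v))" for v
    have "\<iota> \<gamma> = (\<Sum>b\<in>B. of_int (k b) *\<^sub>R \<iota> b)"
      by (simp add: k additive.sum[OF \<iota>(1)] additive_int_scale[OF \<iota>(1)] int_scale_eq_scaleR)
    then have "\<iota> \<gamma> = (\<Sum>v\<in>\<iota> ` B. a v *\<^sub>R v)"
      by (simp add: sum.reindex[OF \<iota>(2)] a_def inv_into_f_f[OF \<iota>(2)])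
    then have "(\<Sum>v\<in>\<iota> ` B. \<bar>a v\<bar>) \<le> R / c"
      using c(2)[of a] R c(1) by (simp add: field_simps)
    then have le: "(\<Sum>b\<in>B. \<bar>real_of_int (k b)\<bar>) \<le> R / c"
      by (simp add: sum.reindex[OF \<iota>(2)] a_def inv_into_f_f[OF \<iota>(2)])
    have "k b \<in> {- n..n}" if "b \<in> B" for b
    proof -
      have "\<bar>real_of_int (k b)\<bar> \<le> (\<Sum>b\<in>B. \<bar>real_of_int (k b)\<bar>)"
        by (rule member_le_sum) (use that assms(1) in auto)
      with le have "\<bar>real_of_int (k b)\<bar> \<le> of_int n" unfolding n_def by linarith
      then show ?thesis by (auto simp: abs_le_iff)
    qed
    then have "restrict k B \<in> B \<rightarrow>\<^sub>E {- n..n}" by auto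
    moreover have "\<gamma> = (\<Sum>b\<in>B. int_scale (restrict k B b) b)" by (simp add: k)
    ultimately show "\<gamma> \<in> (\<lambda>k. \<Sum>b\<in>B. int_scale (k b) b) ` (B \<rightarrow>\<^sub>E {- n..n})" by blast
  qed
  then show ?thesis by (rule finite_subset) (intro finite_imageI finite_PiE assms(1), simp)
qed


text \<open>Pointwise continuity of the charge is upgraded to continuity in operator norm: it is
  enough to control the finitely many values on \<open>B\<close> to within
  \<open>\<delta> / C\<close>, with \<open>C\<close> uniform over linear maps.\<close>

lemma extend_linear_locally_close:
  fixes \<iota> :: "'g::ab_group_add \<Rightarrow> 'v::real_normed_vector"
    and Z :: "'m::topological_space \<Rightarrow> 'g \<Rightarrow> complex" and B :: "'g set"
  assumes B: "finite B" "int_basis B" and \<iota>: "real_extension \<iota>"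
    and add: "\<And>y. Modules.additive (Z y)" and cont: "continuous_on UNIV Z" and "\<delta> > 0"
  shows "\<exists>U. open U \<and> x \<in> U \<and>
    (\<forall>y\<in>U. \<forall>v. cmod (extend_linear \<iota> (Z y) v - extend_linear \<iota> (Z x) v) \<le> \<delta> * norm v)"
proof -
  have B': "finite (\<iota> ` B)" "independent (\<iota> ` B)" "span (\<iota> ` B) = UNIV"
    using B \<iota> by (auto simp: real_extension_def)
  obtain C where C: "C > 0" "\<And>(f :: 'v \<Rightarrow> complex) M v.
      linear f \<Longrightarrow> (\<And>b. b \<in> \<iota> ` B \<Longrightarrow> norm (f b) \<le> M) \<Longrightarrow> norm (f v) \<le> C * M * norm v"
    using finite_basis_linear_norm_bound[OF B'] by blast
  define U where "U = (\<Inter>b\<in>B. {y. dist (Z y b) (Z x b) < \<delta> / C})"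
  have "open U"
    unfolding U_def
    by (intro open_INT B(1) ballI open_Collect_less continuous_intros
        continuous_on_product_then_coordinatewise[OF cont])
  moreover have "x \<in> U" using C(1) \<open>\<delta> > 0\<close> by (simp add: U_def)
  moreover have "cmod (extend_linear \<iota> (Z y) v - extend_linear \<iota> (Z x) v) \<le> \<delta> * norm v"
    if "y \<in> U" for y v
  proof -
    note ext = extend_linear[OF B(2) \<iota> add]
    have "linear (\<lambda>v. extend_linear \<iota> (Z y) v - extend_linear \<iota> (Z x) v)"
      by (intro linear_compose_sub ext)
    then have "cmod (extend_linear \<iota> (Z y) v - extend_linear \<iota> (Z x) v)
        \<le> C * (\<delta> / C) * norm v"
      by (rule C(2)) (use that in \<open>force simp: U_def ext(2) dist_norm\<close>)
    then show ?thesis using C(1) by simp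
  qed
  ultimately show ?thesis by blast
qed

section \<open>Stable supports\<close>

text \<open>The induction also carries that each partial sum maps to a positive multiple of
  \<open>z\<close>, which the addition of two vectors requires.\<close>

lemma quadratic_form_nonneg_sum_list:
  fixes \<iota> :: "'g::ab_group_add \<Rightarrow> 'v::real_vector"
  assumes \<iota>: "Modules.additive \<iota>" and Q: "quadratic_form Q"
    and L: "linear L" and neg: "negative_definite_on {v. L v = 0} Q"
    and as: "as \<noteq> []" "\<And>a. a \<in> set as \<Longrightarrow> (\<exists>t>0. L (\<iota> a) = t *\<^sub>R z) \<and> Q (\<iota> a) \<ge> 0"
  shows "(\<exists>t>0. L (\<iota> (sum_list as)) = t *\<^sub>R z) \<and> Q (\<iota> (sum_list as)) \<ge> 0"
  using as
proof (induction as rule: list_nonempty_induct)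
  case (single a)
  then show ?case by simp
next
  case (cons a as)
  obtain t where t: "t > 0" "L (\<iota> a) = t *\<^sub>R z" "Q (\<iota> a) \<ge> 0" using cons.prems by force
  obtain u where u: "u > 0" "L (\<iota> (sum_list as)) = u *\<^sub>R z" "Q (\<iota> (sum_list as)) \<ge> 0"
    using cons by (metis list.set_intros(2))
  have "L (\<iota> (sum_list (a # as))) = (t + u) *\<^sub>R z"
    by (simp add: additive.add[OF \<iota>] linear_add[OF L] t u scaleR_left_distrib)
  moreover have "Q (\<iota> (sum_list (a # as))) \<ge> 0"
    using quadratic_form_nonneg_add_on_ray[OF Q L neg t(2,1,3) u(2,1,3)]
    by (simp add: additive.add[OF \<iota>])
  ultimately show ?case using t(1) u(1) by (metis add_pos_pos)
qed

section \<open>Acute angles and the growth of norms\<close>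

text \<open>The main term of the inner product is \<open>p * p'\<close>. The three error terms are
  at most 1/4, 1/4 and 1/16 of it, together less than the whole.\<close>

lemma inner_pos_if_close_to_ray:
  fixes w w' z :: "'a::real_inner"
  assumes "z \<noteq> 0" "t > 0" "t' > 0"
    and "norm (w - t *\<^sub>R z) \<le> norm (t *\<^sub>R z) / 4" "norm (w' - t' *\<^sub>R z) \<le> norm (t' *\<^sub>R z) / 4"
  shows "inner w w' > 0"
proof -
  define e e' where "e = w - t *\<^sub>R z" and "e' = w' - t' *\<^sub>R z"
  define p p' where "p = norm (t *\<^sub>R z)" and "p' = norm (t' *\<^sub>R z)"
  have p: "p > 0" "p' > 0" using assms(1-3) by (auto simp: p_def p'_def)
  have e: "norm e \<le> p / 4" "norm e' \<le> p' / 4" using assms by (simp_all add: e_def e'_def p_def p'_def)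
  have "inner (t *\<^sub>R z) (t' *\<^sub>R z) = p * p'"
    using assms(2,3) by (simp add: p_def p'_def dot_square_norm power2_eq_square)
  moreover have "\<bar>inner (t *\<^sub>R z) e'\<bar> \<le> p * p' / 4"
    using order.trans[OF Cauchy_Schwarz_ineq2[of "t *\<^sub>R z" e'], of "p * (p' / 4)"]
      mult_left_mono[OF e(2), of p] p(1) unfolding p_def[symmetric] by linarith
  moreover have "\<bar>inner e (t' *\<^sub>R z)\<bar> \<le> p * p' / 4"
    using order.trans[OF Cauchy_Schwarz_ineq2[of e "t' *\<^sub>R z"], of "(p / 4) * p'"]
      mult_right_mono[OF e(1), of p'] p(2) unfolding p'_def[symmetric] by linarith
  moreover have "norm e * norm e' \<le> (p / 4) * (p' / 4)"
    by (intro mult_mono e) (use p in auto)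
  then have "\<bar>inner e e'\<bar> \<le> p * p' / 16"
    using Cauchy_Schwarz_ineq2[of e e'] by simp
  moreover have "p * p' > 0" using p by simp
  moreover have "w = t *\<^sub>R z + e" "w' = t' *\<^sub>R z + e'" by (simp_all add: e_def e'_def)
  then have "inner w w' = inner (t *\<^sub>R z) (t' *\<^sub>R z) + inner (t *\<^sub>R z) e' + inner e (t' *\<^sub>R z) + inner e e'"
    by (simp only: inner_add_left inner_add_right)
  ultimately show ?thesis by linarith
qed

lemma inner_sum_list_pos:
  assumes "as \<noteq> []" "\<And>a. a \<in> set as \<Longrightarrow> inner w (f a) > 0" "Modules.additive f"
  shows "inner w (f (sum_list as)) > 0"
  using assms(1,2)
  by (induction as rule: list_nonempty_induct)
     (simp_all add: additive.add[OF assms(3)] inner_add_right add_pos_pos)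

lemma norm_less_norm_add:
  fixes u v :: "'a::real_inner"
  assumes "inner u v > 0"
  shows "norm u < norm (u + v)"
proof (rule power2_less_imp_less)
  have "(norm (u + v))\<^sup>2 = (norm u)\<^sup>2 + 2 * inner u v + (norm v)\<^sup>2"
    by (simp add: power2_norm_eq_inner inner_add_left inner_add_right inner_commute)
  then show "(norm u)\<^sup>2 < (norm (u + v))\<^sup>2" using assms by (smt (verit) zero_le_power2)
qed simp

text \<open>
  The size of a vector with \<open>Q < 0\<close> is measured by the fixed charge \<open>W\<close>, not by the charge \<open>Z\<close>
  whose rays govern the decomposition, so that sizes at different points can be compared.
\<close>

lemma stable_support_negative_descent:
  fixes \<iota> :: "'g::ab_group_add \<Rightarrow> 'v::real_normed_vector"
  assumes \<iota>: "Modules.additive \<iota>" and supp: "stable_support \<iota> Z r s"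
    and Q: "quadratic_form Q" and L: "linear L" "\<And>\<gamma>. L (\<iota> \<gamma>) = Z \<gamma>"
    and neg: "negative_definite_on {v. L v = 0} Q"
    and W: "Modules.additive W"
    and close: "\<And>\<gamma>. \<gamma> \<in> s \<Longrightarrow> cmod (W \<gamma> - Z \<gamma>) \<le> cmod (Z \<gamma>) / 4"
    and nonzero: "\<And>\<gamma>. \<gamma> \<in> s \<Longrightarrow> Q (\<iota> \<gamma>) < 0 \<Longrightarrow> Z \<gamma> \<noteq> 0"
    and \<gamma>: "\<gamma> \<in> s" "Q (\<iota> \<gamma>) < 0"
  shows "\<exists>a\<in>r. Q (\<iota> a) < 0 \<and> (a = \<gamma> \<or> cmod (W a) < cmod (W \<gamma>))"
proof -
  define z where "z = Z \<gamma>"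
  have "z \<noteq> 0" using nonzero \<gamma> by (simp add: z_def)
  define l where "l = {t *\<^sub>R z | t. t > 0}"
  have "is_ray l" using \<open>z \<noteq> 0\<close> by (auto simp: is_ray_def l_def)
  have "r \<subseteq> s" using supp by (simp add: stable_support_def)
  have "z = 1 *\<^sub>R z" by simp
  then have "z \<in> l" unfolding l_def using zero_less_one by blast
  then have "\<gamma> \<in> sgr (r \<inter> Z -` l)"
    using supp \<open>is_ray l\<close> \<gamma>(1) unfolding stable_support_def z_def by blast
  then obtain as where as: "\<gamma> = sum_list as" "as \<noteq> []" "set as \<subseteq> r \<inter> Z -` l"
    by (auto simp: sgr_def)
  have ray: "\<exists>t>0. Z a = t *\<^sub>R z" if "a \<in> set as" for a
    using as(3) that by (auto simp: l_def)
  have "\<exists>a\<in>set as. Q (\<iota> a) < 0"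
  proof (rule ccontr)
    assume "\<not> (\<exists>a\<in>set as. Q (\<iota> a) < 0)"
    then have "Q (\<iota> (sum_list as)) \<ge> 0"
      using quadratic_form_nonneg_sum_list[OF \<iota> Q L(1) neg as(2), of z] ray
      by (auto simp: L(2) not_less)
    then show False using \<gamma>(2) as(1) by simp
  qed
  then obtain a where a: "a \<in> set as" "Q (\<iota> a) < 0" by blast
  \<comment> \<open>The case \<open>b = a\<close> is included, since \<open>a\<close> may occur
    several times in \<open>as\<close>.\<close>
  have inner_pos: "inner (W a) (W b) > 0" if b: "b \<in> set as" for b
  proof -
    obtain t t' where t: "t > 0" "Z a = t *\<^sub>R z" "t' > 0" "Z b = t' *\<^sub>R z"
      using ray a(1) b by meson
    have "a \<in> s" "b \<in> s" using as(3) \<open>r \<subseteq> s\<close> a(1) b by auto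
    then show ?thesis
      using inner_pos_if_close_to_ray[OF \<open>z \<noteq> 0\<close> t(1,3), of "W a" "W b"] close[of a] close[of b]
      unfolding t(2,4)[symmetric] by blast
  qed
  \<comment> \<open>Only one occurrence of \<open>a\<close> is removed. If nothing remains,
    \<open>\<gamma>\<close> is \<open>a\<close>; otherwise the rest makes an acute angle with
    \<open>W a\<close>, and adding it strictly increases the length.\<close>
  have "a = \<gamma> \<or> cmod (W a) < cmod (W \<gamma>)"
  proof (cases "remove1 a as = []")
    case True
    then show ?thesis using a(1) as(1) by (cases as) (auto split: if_splits)
  next
    case False
    have "inner (W a) (W (sum_list (remove1 a as))) > 0"
      by (rule inner_sum_list_pos[OF False _ W]) (use inner_pos set_remove1_subset in fast)
    then have "cmod (W a) < cmod (W (a + sum_list (remove1 a as)))"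
      by (simp only: additive.add[OF W] norm_less_norm_add)
    moreover have "\<gamma> = a + sum_list (remove1 a as)"
      using a(1) as(1) by (simp add: sum_list_map_remove1[of a as "\<lambda>x. x", simplified])
    ultimately show ?thesis by simp
  qed
  then show ?thesis using a as(3) by blast
qed

section \<open>Propagation of nonnegativity over a connected neighborhood\<close>

theorem corollary2p15:
  fixes \<iota> :: "'g::ab_group_add \<Rightarrow> 'v::real_normed_vector"
    and Z :: "'m::topological_space \<Rightarrow> 'g \<Rightarrow> complex"
    and r s :: "'m \<Rightarrow> 'g set"
    and Q :: "'v \<Rightarrow> real"
    and x :: 'm
  assumes free: "\<exists>B :: 'g set. finite B \<and> int_basis B"
    and tensor: "real_extension \<iota>"
    and M: "locally path_connected (UNIV :: 'm set)"
    and family: "continuous_family_of_stable_supports \<iota> Z r s"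
    and Q: "quadratic_form Q"
    and neg: "negative_definite_on {v. extend_linear \<iota> (Z x) v = 0} Q"
    and nonneg: "\<forall>\<gamma>\<in>s x. Q (\<iota> \<gamma>) \<ge> 0"
  shows "\<exists>U. open U \<and> x \<in> U \<and> (\<forall>y\<in>U. \<forall>\<gamma>\<in>s y. Q (\<iota> \<gamma>) \<ge> 0)"
proof -
  obtain B :: "'g set" where B: "finite B" "int_basis B" using free by blast
  have \<iota>: "Modules.additive \<iota>" and
    B': "finite (\<iota> ` B)" "independent (\<iota> ` B)" "span (\<iota> ` B) = UNIV"
    using B tensor by (auto simp: real_extension_def)
  have Q0: "Q 0 = 0" using Q by (auto simp: quadratic_form_def bilinear_lzero)
  have supp: "stable_support \<iota> (Z y) (r y) (s y)" for y
    using family by (auto simp: continuous_family_of_stable_supports_def)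
  have cont: "continuous_on UNIV Z"
    and r_open: "open {y. \<gamma> \<in> r y}" and s_closed: "closed {y. \<gamma> \<in> s y}" for \<gamma>
    using family by (auto simp: continuous_family_of_stable_supports_def)
  have add: "Modules.additive (Z y)" and r_sub_s: "r y \<subseteq> s y" for y
    using supp[of y] by (auto simp: stable_support_def)
  obtain \<epsilon> U0 where \<epsilon>: "\<epsilon> > 0" "open U0" "x \<in> U0"
    and bound: "\<And>y \<gamma>. y \<in> U0 \<Longrightarrow> \<gamma> \<in> s y \<Longrightarrow> \<epsilon> * norm (\<iota> \<gamma>) \<le> cmod (Z y \<gamma>)"
    using family unfolding continuous_family_of_stable_supports_def support_bound_def
    by (smt (verit) mem_Collect_eq subsetD)
  define E where "E y = extend_linear \<iota> (Z y)" for y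
  have E: "linear (E y)" "E y (\<iota> \<gamma>) = Z y \<gamma>" for y \<gamma>
    using extend_linear[OF B(2) tensor add] by (auto simp: E_def)
  obtain \<kappa> where \<kappa>: "\<kappa> > 0" "\<And>v. Q v \<ge> 0 \<Longrightarrow> \<kappa> * norm v \<le> cmod (E x v)"
    using negative_definite_kernel_bound[OF B' Q E(1)[of x]] neg by (auto simp: E_def)
  \<comment> \<open>Being below \<open>\<kappa>\<close> preserves negative definiteness on the
    kernel; being at most \<open>\<epsilon> / 4\<close> makes \<open>Z x\<close> differ from
    \<open>Z y\<close> on \<open>s y\<close> by at most a quarter of the length.\<close>
  define \<delta> where "\<delta> = min \<kappa> (\<epsilon> / 2) / 2"
  have \<delta>: "\<delta> > 0" "\<delta> < \<kappa>" "\<delta> \<le> \<epsilon> / 4" using \<kappa>(1) \<epsilon>(1) by (auto simp: \<delta>_def)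
  obtain U1 where U1: "open U1" "x \<in> U1" "\<And>y v. y \<in> U1 \<Longrightarrow> cmod (E y v - E x v) \<le> \<delta> * norm v"
    using extend_linear_locally_close[OF B tensor add cont \<delta>(1), of x] unfolding E_def by blast
  \<comment> \<open>The set \<open>V\<close> need not be open: the clopen argument runs in the
    subspace \<open>V\<close>, and the open set \<open>U\<close> inside it is the final
    neighborhood.\<close>
  obtain U V where UV: "open U" "path_connected V" "x \<in> U" "U \<subseteq> V" "V \<subseteq> U0 \<inter> U1"
    using locallyE[OF M, of "U0 \<inter> U1" x] \<epsilon> U1 by auto
  \<comment> \<open>A nonzero kernel vector of \<open>E y\<close> with \<open>Q \<ge> 0\<close>
    would satisfy \<open>\<kappa> * norm v \<le> cmod (E x v) \<le> \<delta> * norm v\<close>,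
    against \<open>\<delta> < \<kappa>\<close>.\<close>
  have neg_V: "negative_definite_on {v. E y v = 0} Q" if "y \<in> V" for y
    unfolding negative_definite_on_def
  proof (intro ballI impI, rule ccontr)
    fix v assume v: "v \<in> {v. E y v = 0}" "v \<noteq> 0" "\<not> Q v < 0"
    have "y \<in> U1" using UV(5) that by blast
    have "\<kappa> * norm v \<le> cmod (E x v)" using \<kappa>(2) v(3) by simp
    also have "\<dots> \<le> \<delta> * norm v" using U1(3)[OF \<open>y \<in> U1\<close>, of v] v(1) by simp
    finally have "\<kappa> * norm v \<le> \<delta> * norm v" .
    then show False using \<delta>(2) v(2) by simp
  qed
  have bound_V: "\<epsilon> * norm (\<iota> \<gamma>) \<le> cmod (Z y \<gamma>)" if "y \<in> V" "\<gamma> \<in> s y" for y \<gamma>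
    using bound that UV(5) by blast
  have close: "cmod (Z x \<gamma> - Z y \<gamma>) \<le> cmod (Z y \<gamma>) / 4" if "y \<in> V" "\<gamma> \<in> s y" for y \<gamma>
  proof -
    have "cmod (Z x \<gamma> - Z y \<gamma>) \<le> \<delta> * norm (\<iota> \<gamma>)"
      using U1(3)[of y "\<iota> \<gamma>"] UV(5) that by (auto simp: E(2) norm_minus_commute)
    also have "\<dots> \<le> \<epsilon> / 4 * norm (\<iota> \<gamma>)" using \<delta>(3) by (intro mult_right_mono) auto
    finally show ?thesis using bound_V[OF that] by simp
  qed
  have descent: "\<exists>a\<in>r y. Q (\<iota> a) < 0 \<and> (a = \<gamma> \<or> cmod (Z x a) < cmod (Z x \<gamma>))"
    if "y \<in> V" "\<gamma> \<in> s y" "Q (\<iota> \<gamma>) < 0" for y \<gamma>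
  proof (rule stable_support_negative_descent[OF \<iota> supp Q E(1)[of y] E(2)])
    show "negative_definite_on {v. E y v = 0} Q" "Modules.additive (Z x)"
      using neg_V that(1) add by auto
    show "cmod (Z x \<gamma> - Z y \<gamma>) \<le> cmod (Z y \<gamma>) / 4" if "\<gamma> \<in> s y" for \<gamma>
      using close \<open>y \<in> V\<close> that by blast
    show "Z y \<gamma> \<noteq> 0" if \<gamma>: "\<gamma> \<in> s y" "Q (\<iota> \<gamma>) < 0" for \<gamma>
    proof
      assume "Z y \<gamma> = 0"
      then have "\<iota> \<gamma> = 0"
        using bound_V[OF \<open>y \<in> V\<close> \<gamma>(1)] \<epsilon>(1) by (simp add: mult_le_0_iff)
      then show False using \<gamma>(2) Q0 by simp
    qed
  qed fact+
  have "Q (\<iota> \<gamma>) \<ge> 0" if y: "y \<in> V" and \<gamma>: "\<gamma> \<in> s y" for y \<gamma>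
  proof (rule ccontr)
    assume "\<not> Q (\<iota> \<gamma>) \<ge> 0"
    define N where "N = cmod (Z x \<gamma>)"
    \<comment> \<open>The norm condition secures finiteness, as \<open>Z x\<close> may have a
      kernel. It costs nothing on the supports: by \<open>close\<close>,
      \<open>cmod (Z x a) \<le> N\<close> gives \<open>cmod (Z y' a) \<le> 4 * N / 3\<close>, hence
      at most \<open>2 * N\<close>, and the support bound divides by
      \<open>\<epsilon>\<close>.\<close>
    define F where "F = {a. norm (\<iota> a) \<le> 2 * N / \<epsilon> \<and> Q (\<iota> a) < 0 \<and> cmod (Z x a) \<le> N}"
    have "finite F"
      by (rule finite_subset[OF _ finite_lattice_norm_le[OF B tensor, of "2 * N / \<epsilon>"]])
         (auto simp: F_def)
    have in_F: "a \<in> F" if a: "y' \<in> V" "a \<in> s y'" "Q (\<iota> a) < 0" "cmod (Z x a) \<le> N" for y' a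
    proof -
      have "cmod (Z y' a) \<le> cmod (Z x a) + cmod (Z x a - Z y' a)"
        by (metis norm_minus_commute norm_triangle_sub)
      then have "cmod (Z y' a) \<le> 2 * N"
        using close[OF a(1,2)] a(4) norm_ge_zero[of "Z y' a"] by linarith
      then show ?thesis using bound_V[OF a(1,2)] a(3,4) \<epsilon>(1) by (simp add: F_def field_simps)
    qed
    define A where "A = V \<inter> (\<Union>a\<in>F. {y. a \<in> s y})"
    \<comment> \<open>Replacing \<open>s\<close> by \<open>r\<close> in the description of
      \<open>A\<close> turns closed conditions into open ones. An element \<open>a\<close> of
      \<open>F \<inter> s y'\<close> of least \<open>cmod (Z x a)\<close> already lies in
      \<open>r y'\<close>: the descent produces some \<open>b\<close> in \<open>r y'\<close> that is
      again in \<open>F\<close>, and minimality leaves only \<open>b = a\<close>.\<close>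
    have "A \<subseteq> V \<inter> (\<Union>a\<in>F. {y. a \<in> r y})"
    proof
      fix y' assume "y' \<in> A"
      then have "y' \<in> V" and ne: "F \<inter> s y' \<noteq> {}" by (auto simp: A_def)
      obtain a where a: "a \<in> F \<inter> s y'"
        "\<And>b. b \<in> F \<inter> s y' \<Longrightarrow> cmod (Z x a) \<le> cmod (Z x b)"
        using arg_min_if_finite[of "F \<inter> s y'" "\<lambda>a. cmod (Z x a)"] \<open>finite F\<close> ne
        by (meson finite_Int not_le)
      then have a': "Q (\<iota> a) < 0" "cmod (Z x a) \<le> N" "a \<in> s y'" by (auto simp: F_def)
      obtain b where b: "b \<in> r y'" "Q (\<iota> b) < 0" "b = a \<or> cmod (Z x b) < cmod (Z x a)"
        using descent[OF \<open>y' \<in> V\<close> a'(3,1)] by blast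
      then have "b \<in> F \<inter> s y'"
        using in_F[OF \<open>y' \<in> V\<close>, of b] r_sub_s a'(2) by force
      then have "b = a" using a(2)[of b] b(3) by linarith
      then show "y' \<in> V \<inter> (\<Union>a\<in>F. {y. a \<in> r y})" using b(1) a(1) \<open>y' \<in> V\<close> by blast
    qed
    moreover have "V \<inter> (\<Union>a\<in>F. {y. a \<in> r y}) \<subseteq> A"
      unfolding A_def by (intro Int_mono UN_mono order.refl) (use r_sub_s in blast)
    ultimately have "A = V \<inter> (\<Union>a\<in>F. {y. a \<in> r y})" by (rule equalityI)
    then have "openin (top_of_set V) A"
      by (simp only:) (intro openin_open_Int open_UN ballI r_open)
    moreover have "closedin (top_of_set V) A"
      unfolding A_def by (intro closedin_closed_Int closed_UN \<open>finite F\<close> ballI s_closed)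
    moreover have "connected V" using UV(2) by (rule path_connected_imp_connected)
    \<comment> \<open>Both alternatives fail: \<open>y\<close> is in \<open>A\<close> because
      \<open>\<gamma>\<close> is in \<open>F\<close>, and \<open>x\<close> is not, because
      \<open>Q\<close> is negative on all of \<open>F\<close> and nonnegative on
      \<open>s x\<close>.\<close>
    ultimately have "A = {} \<or> A = V" by (simp add: connected_clopen)
    moreover have "y \<in> A"
      using in_F[OF y \<gamma>] \<open>\<not> Q (\<iota> \<gamma>) \<ge> 0\<close> y \<gamma> by (auto simp: A_def N_def)
    moreover have "x \<notin> A" using nonneg by (force simp: A_def F_def)
    ultimately show False using UV(3,4) by blast
  qed
  then show ?thesis using UV(1,3,4) by blast
qed

end
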